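(* Let $\Omega\subset\mathbb{R}^n$ be a bounded open set with diameter $\ell$, let $x_0\in\Omega$, $1\le p<\infty$, $0\le\lambda\le n$ and $A>\ell$. Then $$L^p(\Omega,|y-x_0|^{\lambda(p-1)})\hookrightarrow {}^{\complement}\mathcal{L}^{p,\lambda}_{\{x_0\}}(\Omega)\hookrightarrow \bigcap_{\varepsilon>0}L^p\left(\Omega,\frac{|y-x_0|^{\lambda(p-1)}}{\left(\ln\frac{A}{|y-x_0|}\right)^{1+\varepsilon}}\right),$$ where both embeddings are strict, with the counterexamples $$f(x)=\frac{1}{|x-x_0|^{\frac np+\frac{\lambda}{p'}}}\quad\text{and}\quad g(x)=\frac{\ln\left(\ln\frac{B}{|x-x_0|}\right)}{|x-x_0|^{\frac np+\frac{\lambda}{p'}}},\qquad B>\ell e^e:$$ $$f\in {}^{\complement}\mathcal{L}^{p,\lambda}_{\{x_0\}}(\Omega)\quad\text{but}\quad f\notin L^p(\Omega,|y-x_0|^{\lambda(p-1)}),$$ and $$g\in\bigcap_{\varepsilon>0}L^p\left(\Omega,\frac{|y-x_0|^{\lambda(p-1)}}{\left(\ln\frac{A}{|y-x_0|}\right)^{1+\varepsilon}}\right)\quad\text{but}\quad g\notin {}^{\complement}\mathcal{L}^{p,\lambda}_{\{x_0\}}(\Omega).$$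
   Context: For a weight $\varrho$ on $\Omega$, $L^p(\Omega,\varrho)=\{f:\int_\Omega\varrho(y)|f(y)|^p\,dy<\infty\}$, with norm $\left(\int_\Omega\varrho(y)|f(y)|^p\,dy\right)^{1/p}$. The exponent $p'$ is the conjugate exponent, $\frac1{p'}=1-\frac1p$ (so $\frac{\lambda}{p'}=0$ if $p=1$). $B(x_0,r)$ is the open ball of radius $r$ about $x_0$ (not to be confused with the constant $B$ in the definition of $g$). The local "complementary" Morrey space ${}^{\complement}\mathcal{L}^{p,\lambda}_{\{x_0\}}(\Omega)$ is the space of all $f\in L^p_{\rm loc}(\Omega\setminus\{x_0\})$ with finite norm $$\|f\|_{{}^{\complement}\mathcal{L}^{p,\lambda}_{\{x_0\}}(\Omega)}=\sup_{r>0}r^{\frac{\lambda}{p'}}\|f\|_{L^p(\Omega\setminus B(x_0,r))}.$$ The symbol $\hookrightarrow$ denotes continuous embedding (for the intersection: continuous embedding into each of the spaces with $\varepsilon>0$); "strict" means the inclusion is proper.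
   Formalization: Strictness of the first embedding and the counterexample f are claimed only for p > 1 and λ > 0; if p = 1 or λ = 0 the first two spaces coincide with L^p(Ω) and f lies in neither, so the claim as stated fails there. *)

theory Defs
  imports "HOL-Analysis.Analysis"
begin

text \<open>
  Spaces are sets of representatives: real functions on the whole space of which only the values
  on the domain matter, not quotiented by equality almost everywhere. Membership and norms are
  invariant under changes on null sets, so inclusion, properness of an inclusion and norm estimates
  mean the same as for equivalence classes. For the same reason the values which the total functions
  below take at the single point \<open>y = x0\<close> (such as \<open>0 powr 0 = 0\<close>, \<open>1 / 0 = 0\<close>, \<open>ln 0 = 0\<close>)
  are irrelevant.
\<close>

definition Lp_int :: "real \<Rightarrow> 'a::euclidean_space set \<Rightarrow> ('a \<Rightarrow> real) \<Rightarrow> ('a \<Rightarrow> real) \<Rightarrow> ennreal" where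
  "Lp_int p S w f = (\<integral>\<^sup>+ y. ennreal (w y * \<bar>f y\<bar> powr p) \<partial>lebesgue_on S)"

definition Lp_space :: "real \<Rightarrow> 'a::euclidean_space set \<Rightarrow> ('a \<Rightarrow> real) \<Rightarrow> ('a \<Rightarrow> real) set" where
  "Lp_space p S w = {f \<in> borel_measurable (lebesgue_on S). Lp_int p S w f < \<infinity>}"

definition Lp_norm :: "real \<Rightarrow> 'a::euclidean_space set \<Rightarrow> ('a \<Rightarrow> real) \<Rightarrow> ('a \<Rightarrow> real) \<Rightarrow> ennreal" where
  "Lp_norm p S w f =
     (if Lp_int p S w f < \<infinity> then ennreal (enn2real (Lp_int p S w f) powr (1 / p)) else \<infinity>)"

definition Lp_loc :: "real \<Rightarrow> 'a::euclidean_space set \<Rightarrow> ('a \<Rightarrow> real) set" where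
  "Lp_loc p U = {f \<in> borel_measurable (lebesgue_on U).
     \<forall>K. compact K \<and> K \<subseteq> U \<longrightarrow> f \<in> Lp_space p K (\<lambda>_. 1)}"

text \<open>
  The reciprocal \<open>1 / p'\<close> of the conjugate exponent is written as \<open>1 - 1 / p\<close>, which is \<open>0\<close> for
  \<open>p = 1\<close>, where \<open>p'\<close> is infinite.
\<close>

definition compl_Morrey_norm ::
    "real \<Rightarrow> real \<Rightarrow> 'a::euclidean_space \<Rightarrow> 'a set \<Rightarrow> ('a \<Rightarrow> real) \<Rightarrow> ennreal" where
  "compl_Morrey_norm p lam x0 \<Omega> f =
     (SUP r\<in>{0<..}. ennreal (r powr (lam * (1 - 1 / p))) * Lp_norm p (\<Omega> - ball x0 r) (\<lambda>_. 1) f)"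

definition compl_Morrey ::
    "real \<Rightarrow> real \<Rightarrow> 'a::euclidean_space \<Rightarrow> 'a set \<Rightarrow> ('a \<Rightarrow> real) set" where
  "compl_Morrey p lam x0 \<Omega> = {f \<in> Lp_loc p (\<Omega> - {x0}). compl_Morrey_norm p lam x0 \<Omega> f < \<infinity>}"

definition power_weight :: "real \<Rightarrow> real \<Rightarrow> 'a::euclidean_space \<Rightarrow> 'a \<Rightarrow> real" where
  "power_weight p lam x0 y = norm (y - x0) powr (lam * (p - 1))"

definition log_weight :: "real \<Rightarrow> real \<Rightarrow> real \<Rightarrow> real \<Rightarrow> 'a::euclidean_space \<Rightarrow> 'a \<Rightarrow> real" where
  "log_weight p lam A \<epsilon> x0 y =
     norm (y - x0) powr (lam * (p - 1)) / ln (A / norm (y - x0)) powr (1 + \<epsilon>)"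

text \<open>Inclusion, together with boundedness of the (linear) inclusion map.\<close>

definition continuously_embedded ::
    "('f set) \<Rightarrow> ('f \<Rightarrow> ennreal) \<Rightarrow> ('f set) \<Rightarrow> ('f \<Rightarrow> ennreal) \<Rightarrow> bool" where
  "continuously_embedded X NX Y NY \<longleftrightarrow>
     X \<subseteq> Y \<and> (\<exists>C\<ge>0::real. \<forall>f\<in>X. NY f \<le> ennreal C * NX f)"

end

theory Submission
  imports Defs
begin

text \<open>
  Write \<open>\<rho> = |y - x0|\<close>, \<open>n\<close> for the dimension and \<open>\<beta> = lam (p - 1)\<close>. Raising the norm to the power
  \<open>p\<close> turns \<open>r powr (lam / p')\<close> into \<open>r powr \<beta>\<close>, so that a function lies in the complementary
  Morrey space iff its tails satisfy \<open>\<integral> |f|^p \<le> K r^(-\<beta>)\<close> over \<open>\<rho> \<ge> r\<close>, for all \<open>r > 0\<close>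
  (\<open>mem_compl_Morrey_iff\<close>, \<open>compl_Morrey_norm_le_iff\<close>). Everything is read off from these tails.

  The first embedding is Chebyshev's inequality: \<open>r^\<beta> \<le> \<rho>^\<beta>\<close> on the tail. For the second, cut the
  domain into dyadic shells on which \<open>\<rho>\<close> is about \<open>D 2^(-k)\<close>, where \<open>D\<close> bounds \<open>\<rho>\<close>. The tail bound
  makes the integral of \<open>\<rho>^\<beta> |f|^p\<close> over every shell at most a fixed multiple of \<open>K\<close>, and the
  logarithm is at least a multiple of \<open>k + 1\<close> there, so the weighted integral is dominated by
  \<open>K\<close> times the convergent series of \<open>(k + 1)^(-1-\<epsilon>)\<close>
  (\<open>log_weight_integral_le_tail_bound\<close>).

  The example \<open>f\<close> has \<open>|f|^p = \<rho>^(-n-\<beta>)\<close>. If \<open>\<beta> > 0\<close>, summing over the shells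
  \<open>r 2^k \<le> \<rho> < r 2^(k+1)\<close> gives a geometric series and a tail of order \<open>r^(-\<beta>)\<close>
  (\<open>power_tail_integral_le\<close>), whereas the weighted integral is that of \<open>\<rho>^(-n)\<close>, to which all dyadic
  shells contribute equally (\<open>critical_power_integral_ball\<close>). The example \<open>g\<close> carries the additional
  factor \<open>(ln ln (B/\<rho>))^p\<close>. This is unbounded, so a single shell \<open>s \<le> \<rho> < 2 s\<close> with \<open>s\<close> small
  violates the tail bound; but it is \<open>O((ln (A/\<rho>))^(\<epsilon>/2))\<close>, so the logarithmic weight with
  exponent \<open>1 + \<epsilon>\<close> absorbs it and leaves a convergent integral of \<open>\<rho>^(-n) / (ln (A/\<rho>))^(1+\<epsilon>/2)\<close>.
\<close>

section \<open>Dyadic estimates for functions of one radius\<close>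

text \<open>
  The common form of both dyadic arguments: the pieces \<open>E k\<close> may overlap, since only the upper
  bound of \<open>h\<close> by the sum of the step functions \<open>b k * indicator (E k)\<close> matters. For the same reason
  a shell may be enlarged to a whole tail or a whole ball, whose measure is the quantity controlled.
\<close>

lemma nn_integral_le_suminf_cover:
  fixes h :: "'a \<Rightarrow> ennreal" and b m :: "nat \<Rightarrow> real"
  assumes E: "\<And>k. E k \<in> sets M"
    and m: "\<And>k. emeasure M (E k) \<le> ennreal (m k)"
    and b: "\<And>k. 0 \<le> b k" and m0: "\<And>k. 0 \<le> m k"
    and summ: "summable (\<lambda>k. b k * m k)"
    and cover: "\<And>x. \<lbrakk>x \<in> space M; h x \<noteq> 0\<rbrakk> \<Longrightarrow> \<exists>k. x \<in> E k \<and> h x \<le> ennreal (b k)"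
  shows "(\<integral>\<^sup>+x. h x \<partial>M) \<le> ennreal (\<Sum>k. b k * m k)"
proof -
  note E [measurable]
  have "(\<integral>\<^sup>+x. h x \<partial>M) \<le> (\<integral>\<^sup>+x. (\<Sum>k. ennreal (b k) * indicator (E k) x) \<partial>M)"
  proof (rule nn_integral_mono)
    fix x assume x: "x \<in> space M"
    show "h x \<le> (\<Sum>k. ennreal (b k) * indicator (E k) x)"
    proof (cases "h x = 0")
      case False
      then obtain k where k: "x \<in> E k" "h x \<le> ennreal (b k)"
        using cover x by blast
      have "h x \<le> (\<Sum>i\<in>{k}. ennreal (b i) * indicator (E i) x)"
        using k by simp
      also have "\<dots> \<le> (\<Sum>i. ennreal (b i) * indicator (E i) x)"
        by (rule sum_le_suminf) auto
      finally show ?thesis .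
    qed simp
  qed
  also have "\<dots> = (\<Sum>k. ennreal (b k) * emeasure M (E k))"
    by (simp add: nn_integral_suminf nn_integral_cmult_indicator)
  also have "\<dots> \<le> (\<Sum>k. ennreal (b k * m k))"
    using m b by (intro suminf_le) (auto simp: ennreal_mult' intro!: mult_left_mono)
  also have "\<dots> = ennreal (\<Sum>k. b k * m k)"
    using b m0 summ by (intro suminf_ennreal2) auto
  finally show ?thesis .
qed

lemma dyadic_shell_inward:
  fixes t D :: real
  assumes "0 < t" "t \<le> D"
  obtains k :: nat where "D / 2 ^ Suc k < t" "t \<le> D / 2 ^ k"
proof -
  have "\<exists>k. D / 2 ^ Suc k < t"
  proof -
    obtain k :: nat where "D / t < 2 ^ k"
      using real_arch_pow[of 2 "D / t"] by auto
    then have "D / 2 ^ Suc k < t"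
      using assms by (simp add: field_simps)
    then show ?thesis ..
  qed
  define k where "k = (LEAST k. D / 2 ^ Suc k < t)"
  have 1: "D / 2 ^ Suc k < t"
    unfolding k_def using \<open>\<exists>k. _\<close> by (rule LeastI_ex)
  have "t \<le> D / 2 ^ k"
  proof (cases k)
    case (Suc j)
    then have "\<not> D / 2 ^ Suc j < t"
      unfolding k_def using not_less_Least[of j "\<lambda>k. D / 2 ^ Suc k < t"] by simp
    with Suc show ?thesis by simp
  qed (use assms in simp)
  with 1 that show thesis by blast
qed

lemma dyadic_shell_outward:
  fixes t r :: real
  assumes "0 < r" "r \<le> t"
  obtains k :: nat where "r * 2 ^ k \<le> t" "t < r * 2 ^ Suc k"
proof -
  have "0 < 1 / t" "1 / t \<le> 1 / r"
    using assms by (auto simp: frac_le)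
  then obtain k where "1 / r / 2 ^ Suc k < 1 / t" "1 / t \<le> 1 / r / 2 ^ k"
    by (rule dyadic_shell_inward)
  then have "r * 2 ^ k \<le> t" "t < r * 2 ^ Suc k"
    using assms by (auto simp: field_simps)
  with that show thesis by blast
qed

text \<open>
  The minimum is a number \<open>c > 0\<close> such that \<open>ln (A / t) \<ge> c (k + 1)\<close> for every \<open>t \<le> D / 2 ^ k\<close>; the
  factor \<open>2 powr \<beta>\<close> is the oscillation of \<open>t powr \<beta>\<close> over one dyadic shell
  (largest over smallest value). The constant is given
  explicitly because the embedding needs one that serves all functions at once.
\<close>

definition log_tail_const :: "real \<Rightarrow> real \<Rightarrow> real \<Rightarrow> real \<Rightarrow> real" where
  "log_tail_const D A \<beta> \<epsilon> =
    min (ln (A / D)) (ln 2) powr - (1 + \<epsilon>) * 2 powr \<beta> * (\<Sum>k. real (Suc k) powr - (1 + \<epsilon>))"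

lemma summable_Suc_powr:
  assumes "0 < \<epsilon>"
  shows "summable (\<lambda>k. real (Suc k) powr - (1 + \<epsilon>))"
  using summable_real_powr_iff[of "- (1 + \<epsilon>)"] assms by (subst summable_Suc_iff) auto

lemma log_tail_const_pos:
  assumes "0 < D" "D < A" "0 < \<epsilon>"
  shows "0 < log_tail_const D A \<beta> \<epsilon>"
proof -
  have "0 < min (ln (A / D)) (ln 2) powr - (1 + \<epsilon>)"
    using assms unfolding powr_gt_zero by (simp add: min_def)
  moreover have "0 < (\<Sum>k. real (Suc k) powr - (1 + \<epsilon>))"
    by (rule suminf_pos[OF summable_Suc_powr[OF assms(3)]]) auto
  ultimately show ?thesis
    unfolding log_tail_const_def by (intro mult_pos_pos) auto
qed

text \<open>
  The heart of the second embedding, for an arbitrary measure \<open>N\<close> and radius function \<open>\<rho>\<close>; it is used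
  with \<open>N\<close> having density \<open>|f|^p\<close>. The shell \<open>D / 2 ^ Suc k < \<rho> \<le> D / 2 ^ k\<close> lies in the tail
  \<open>D / 2 ^ Suc k \<le> \<rho>\<close>. The measure of this tail times the largest value of \<open>\<rho> powr \<beta>\<close> on the shell
  is at most \<open>2 powr \<beta> * K\<close>, whatever \<open>k\<close>, so only the logarithms are left to
  be summed. Points with \<open>\<rho> = 0\<close> are in no shell; the integrand vanishes there because
  \<open>0 powr \<beta> = 0\<close>.
\<close>

lemma log_weight_integral_le_tail_bound:
  fixes \<rho> :: "'a \<Rightarrow> real" and D A \<beta> \<epsilon> K :: real
  assumes D: "0 < D" "D < A" and \<beta>: "0 \<le> \<beta>" and \<epsilon>: "0 < \<epsilon>" and K: "0 \<le> K"
    and meas [measurable]: "\<rho> \<in> borel_measurable N"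
    and \<rho>: "\<And>x. x \<in> space N \<Longrightarrow> 0 \<le> \<rho> x \<and> \<rho> x \<le> D"
    and tail: "\<And>r. 0 < r \<Longrightarrow> emeasure N {x \<in> space N. r \<le> \<rho> x} \<le> ennreal (K * r powr - \<beta>)"
  shows "(\<integral>\<^sup>+x. ennreal (\<rho> x powr \<beta> / ln (A / \<rho> x) powr (1 + \<epsilon>)) \<partial>N)
    \<le> ennreal (log_tail_const D A \<beta> \<epsilon> * K)"
proof -
  define c where "c = min (ln (A / D)) (ln 2)"
  define S where "S = (\<Sum>k. real (Suc k) powr - (1 + \<epsilon>))"
  have c: "0 < c" using D by (simp add: c_def)
  define b where "b k = (D / 2 ^ k) powr \<beta> * (c * real (Suc k)) powr - (1 + \<epsilon>)" for k
  define m where "m k = K * (D / 2 ^ Suc k) powr - \<beta>" for k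
  define E where "E k = {x \<in> space N. D / 2 ^ Suc k \<le> \<rho> x}" for k
  have bm: "b k * m k = c powr - (1 + \<epsilon>) * 2 powr \<beta> * K * real (Suc k) powr - (1 + \<epsilon>)" for k
  proof -
    have "(D / 2 ^ Suc k) powr - \<beta> = (D / 2 ^ k / 2) powr - \<beta>"
      by (simp add: field_simps)
    also have "\<dots> = (D / 2 ^ k) powr - \<beta> * 2 powr \<beta>"
      using D by (subst powr_divide) (auto simp: powr_minus field_simps)
    finally have "(D / 2 ^ k) powr \<beta> * (D / 2 ^ Suc k) powr - \<beta> = 2 powr \<beta>"
      using D by (simp add: powr_minus field_simps)
    moreover have "b k * m k = (D / 2 ^ k) powr \<beta> * (D / 2 ^ Suc k) powr - \<beta>
        * (K * (c * real (Suc k)) powr - (1 + \<epsilon>))"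
      by (simp only: b_def m_def mult_ac)
    moreover have "(c * real (Suc k)) powr - (1 + \<epsilon>) = c powr - (1 + \<epsilon>) * real (Suc k) powr - (1 + \<epsilon>)"
      using c by (subst powr_mult) auto
    ultimately show ?thesis
      by (simp only: mult_ac)
  qed
  have sum_bm: "(\<lambda>k. b k * m k) sums (c powr - (1 + \<epsilon>) * 2 powr \<beta> * K * S)"
    unfolding bm S_def by (intro sums_mult summable_sums summable_Suc_powr \<epsilon>)
  have "(\<integral>\<^sup>+x. ennreal (\<rho> x powr \<beta> / ln (A / \<rho> x) powr (1 + \<epsilon>)) \<partial>N) \<le> ennreal (\<Sum>k. b k * m k)"
  proof (rule nn_integral_le_suminf_cover)
    show "E k \<in> sets N" for k unfolding E_def by measurable
    show "emeasure N (E k) \<le> ennreal (m k)" for k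
      unfolding E_def m_def using D by (intro tail) auto
    show "0 \<le> b k" "0 \<le> m k" for k
      using K by (auto simp: b_def m_def)
    show "summable (\<lambda>k. b k * m k)"
      using sum_bm by (rule sums_summable)
  next
    fix x assume x: "x \<in> space N" and "ennreal (\<rho> x powr \<beta> / ln (A / \<rho> x) powr (1 + \<epsilon>)) \<noteq> 0"
    then have "\<rho> x \<noteq> 0" by (intro notI) simp
    then have "0 < \<rho> x" "\<rho> x \<le> D" using \<rho>[OF x] by auto
    then obtain k where k: "D / 2 ^ Suc k < \<rho> x" "\<rho> x \<le> D / 2 ^ k"
      by (rule dyadic_shell_inward)
    have "c * real (Suc k) \<le> ln (A / D) + real k * ln 2"
      unfolding c_def by (simp add: algebra_simps) (smt (verit, best) mult_left_mono of_nat_0_le_iff)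
    also have "\<dots> = ln (A / (D / 2 ^ k))"
      using D by (simp add: ln_mult ln_div ln_realpow)
    also have "\<dots> \<le> ln (A / \<rho> x)"
      using k D \<open>0 < \<rho> x\<close> by (intro ln_mono divide_left_mono mult_pos_pos divide_pos_pos) auto
    finally have "ln (A / \<rho> x) powr - (1 + \<epsilon>) \<le> (c * real (Suc k)) powr - (1 + \<epsilon>)"
      using c \<epsilon> by (intro powr_mono2') auto
    moreover have "\<rho> x powr \<beta> \<le> (D / 2 ^ k) powr \<beta>"
      using k \<beta> \<open>0 < \<rho> x\<close> by (intro powr_mono2) auto
    ultimately have "\<rho> x powr \<beta> * ln (A / \<rho> x) powr - (1 + \<epsilon>) \<le> b k"
      unfolding b_def by (intro mult_mono) auto
    then have "ennreal (\<rho> x powr \<beta> / ln (A / \<rho> x) powr (1 + \<epsilon>)) \<le> ennreal (b k)"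
      by (intro ennreal_leI) (simp only: powr_minus_divide times_divide_eq_right mult_1_right)
    moreover have "x \<in> E k" using k x by (simp add: E_def)
    ultimately show "\<exists>k. x \<in> E k \<and> ennreal (\<rho> x powr \<beta> / ln (A / \<rho> x) powr (1 + \<epsilon>)) \<le> ennreal (b k)"
      by blast
  qed
  also have "(\<Sum>k. b k * m k) = log_tail_const D A \<beta> \<epsilon> * K"
    using sum_bm by (simp add: sums_iff log_tail_const_def c_def S_def mult_ac)
  finally show ?thesis .
qed

text \<open>
  Only the growth of the measure of the balls \<open>\<rho> < s\<close> enters, which replaces integration in polar
  coordinates. The shell \<open>r * 2 ^ k \<le> \<rho> < r * 2 ^ Suc k\<close> contributes \<open>(r * 2 ^ k) powr - \<beta>\<close> up to a
  constant, a geometric series with ratio \<open>2 powr - \<beta> < 1\<close>.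
\<close>

lemma power_tail_integral_le:
  fixes \<rho> :: "'a \<Rightarrow> real" and V d \<beta> r :: real
  assumes \<beta>: "0 < \<beta>" and d: "0 \<le> d" and V: "0 \<le> V" and r: "0 < r"
    and meas [measurable]: "\<rho> \<in> borel_measurable M"
    and vol: "\<And>s. 0 < s \<Longrightarrow> emeasure M {x \<in> space M. \<rho> x < s} \<le> ennreal (V * s powr d)"
  shows "(\<integral>\<^sup>+x. ennreal (\<rho> x powr - (d + \<beta>)) * indicator {x. r \<le> \<rho> x} x \<partial>M)
    \<le> ennreal (V * 2 powr d / (1 - 2 powr - \<beta>) * r powr - \<beta>)"
proof -
  define b where "b k = (r * 2 ^ k) powr - (d + \<beta>)" for k
  define m where "m k = V * (r * 2 ^ Suc k) powr d" for k
  define E where "E k = {x \<in> space M. \<rho> x < r * 2 ^ Suc k}" for k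
  have bm: "b k * m k = V * 2 powr d * r powr - \<beta> * (2 powr - \<beta>) ^ k" for k
  proof -
    have "b k * m k = V * 2 powr d * ((r * 2 ^ k) powr - (d + \<beta>) * (r * 2 ^ k) powr d)"
      using r by (simp add: b_def m_def powr_mult mult_ac)
    also have "(r * 2 ^ k) powr - (d + \<beta>) * (r * 2 ^ k) powr d = (r * 2 ^ k) powr - \<beta>"
      by (simp flip: powr_add)
    also have "\<dots> = r powr - \<beta> * (2 powr - \<beta>) ^ k"
      using r by (simp add: powr_mult powr_powr mult.commute flip: powr_realpow)
    finally show ?thesis by simp
  qed
  have sum_bm: "(\<lambda>k. b k * m k) sums (V * 2 powr d * r powr - \<beta> * (1 / (1 - 2 powr - \<beta>)))"
    unfolding bm using \<beta> by (intro sums_mult geometric_sums) (simp add: powr_less_one)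
  have "(\<integral>\<^sup>+x. ennreal (\<rho> x powr - (d + \<beta>)) * indicator {x. r \<le> \<rho> x} x \<partial>M) \<le> ennreal (\<Sum>k. b k * m k)"
  proof (rule nn_integral_le_suminf_cover)
    show "E k \<in> sets M" for k unfolding E_def by measurable
    show "emeasure M (E k) \<le> ennreal (m k)" for k
      unfolding E_def m_def using r by (intro vol) auto
    show "0 \<le> b k" "0 \<le> m k" for k
      using V by (auto simp: b_def m_def)
    show "summable (\<lambda>k. b k * m k)"
      using sum_bm by (rule sums_summable)
  next
    fix x assume x: "x \<in> space M"
      and "ennreal (\<rho> x powr - (d + \<beta>)) * indicator {x. r \<le> \<rho> x} x \<noteq> 0"
    then have "r \<le> \<rho> x" by (auto split: split_indicator_asm)
    with r obtain k where k: "r * 2 ^ k \<le> \<rho> x" "\<rho> x < r * 2 ^ Suc k"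
      by (rule dyadic_shell_outward)
    have "\<rho> x powr - (d + \<beta>) \<le> b k"
      unfolding b_def using k r d \<beta> by (intro powr_mono2') auto
    moreover have "x \<in> E k" using k x by (simp add: E_def)
    ultimately show "\<exists>k. x \<in> E k \<and>
        ennreal (\<rho> x powr - (d + \<beta>)) * indicator {x. r \<le> \<rho> x} x \<le> ennreal (b k)"
      using \<open>r \<le> \<rho> x\<close> by (auto intro!: exI[of _ k] ennreal_leI)
  qed
  also have "(\<Sum>k. b k * m k) = V * 2 powr d / (1 - 2 powr - \<beta>) * r powr - \<beta>"
    using sum_bm by (simp add: sums_iff mult_ac)
  finally show ?thesis .
qed

section \<open>Weighted integrals, norms and tails\<close>

lemma borel_measurable_radial:
  fixes x0 :: "'a::euclidean_space"
  assumes "\<phi> \<in> borel_measurable borel"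
  shows "(\<lambda>x. \<phi> (norm (x - x0))) \<in> borel_measurable (lebesgue_on S)"
proof -
  note assms [measurable]
  have "(\<lambda>x. \<phi> (norm (x - x0))) \<in> borel_measurable borel" by measurable
  then show ?thesis
    by (intro measurable_restrict_space1 measurable_completion) simp
qed

lemma Lp_norm_le_iff:
  assumes "0 < p" "0 \<le> c"
  shows "Lp_norm p S w f \<le> ennreal c \<longleftrightarrow> Lp_int p S w f \<le> ennreal (c powr p)"
proof (cases "Lp_int p S w f < \<infinity>")
  case True
  then obtain I where I: "0 \<le> I" "Lp_int p S w f = ennreal I"
    by (metis infinity_ennreal_def less_top_ennreal)
  have "I powr (1 / p) \<le> c \<longleftrightarrow> I \<le> c powr p"
  proof
    assume "I powr (1 / p) \<le> c"
    then have "(I powr (1 / p)) powr p \<le> c powr p"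
      using assms by (intro powr_mono2) auto
    then show "I \<le> c powr p"
      using assms I by (simp add: powr_powr)
  next
    assume "I \<le> c powr p"
    then have "I powr (1 / p) \<le> (c powr p) powr (1 / p)"
      using assms I by (intro powr_mono2) auto
    then show "I powr (1 / p) \<le> c"
      using assms by (simp add: powr_powr)
  qed
  then show ?thesis
    using True I assms by (simp add: Lp_norm_def)
next
  case False
  then show ?thesis
    by (simp add: Lp_norm_def top_unique flip: less_top)
qed

lemma Lp_int_mono_set:
  assumes "S \<subseteq> T" "S \<in> sets lebesgue" "T \<in> sets lebesgue"
  shows "Lp_int p S w f \<le> Lp_int p T w f"
  unfolding Lp_int_def using assms
  by (subst (1 2) nn_integral_restrict_space) (auto intro!: nn_integral_mono split: split_indicator)

lemma ennreal_mult_le_ennreal_iff: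
  assumes "0 < a" "0 \<le> M"
  shows "ennreal a * N \<le> ennreal M \<longleftrightarrow> N \<le> ennreal (M / a)"
proof (cases N)
  case (real n)
  then show ?thesis
    using assms by (simp add: ennreal_mult'[symmetric] pos_le_divide_eq mult.commute)
next
  case top
  then show ?thesis using assms by (simp add: ennreal_mult_top top_unique)
qed

text \<open>
  Conjugate exponents disappear here: \<open>lam (1 - 1/p) p = lam (p - 1)\<close>.
\<close>

lemma compl_Morrey_norm_le_iff:
  assumes p: "1 \<le> p" and M: "0 \<le> M"
  shows "compl_Morrey_norm p lam x0 \<Omega> f \<le> ennreal M \<longleftrightarrow>
    (\<forall>r>0. Lp_int p (\<Omega> - ball x0 r) (\<lambda>_. 1) f \<le> ennreal (M powr p * r powr - (lam * (p - 1))))"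
proof -
  have "ennreal (r powr (lam * (1 - 1 / p))) * Lp_norm p (\<Omega> - ball x0 r) (\<lambda>_. 1) f \<le> ennreal M
      \<longleftrightarrow> Lp_int p (\<Omega> - ball x0 r) (\<lambda>_. 1) f \<le> ennreal (M powr p * r powr - (lam * (p - 1)))"
    if r: "0 < r" for r
  proof -
    have "(M / r powr (lam * (1 - 1 / p))) powr p = M powr p / r powr (lam * (1 - 1 / p) * p)"
      using M by (simp add: powr_divide powr_powr)
    also have "lam * (1 - 1 / p) * p = lam * (p - 1)"
      using p by (simp add: field_simps)
    finally have "(M / r powr (lam * (1 - 1 / p))) powr p = M powr p * r powr - (lam * (p - 1))"
      by (simp only: powr_minus_divide times_divide_eq_right mult_1_right)
    then show ?thesis
      using r M p by (simp add: ennreal_mult_le_ennreal_iff Lp_norm_le_iff)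
  qed
  then show ?thesis
    unfolding compl_Morrey_norm_def by (auto simp: SUP_le_iff)
qed

text \<open>
  Local \<open>L^p\<close> functions on \<open>\<Omega> - {x0}\<close> are measurable on \<open>\<Omega> - {x0}\<close> only, while the weighted spaces
  live on \<open>\<Omega>\<close>.
\<close>

lemma borel_measurable_lebesgue_on_insert_point:
  fixes f :: "'a::euclidean_space \<Rightarrow> real"
  assumes S: "S \<in> sets lebesgue" and f: "f \<in> borel_measurable (lebesgue_on (S - {a}))"
  shows "f \<in> borel_measurable (lebesgue_on S)"
proof (rule borel_measurable_if_D)
  have "S - {a} \<in> sets lebesgue" using S by auto
  then have "(\<lambda>x. if x \<in> S - {a} then f x else 0) \<in> borel_measurable lebesgue"
    using f borel_measurable_if[of "S - {a}" f] by blast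
  moreover have "(\<lambda>x. f a * indicator ({a} \<inter> S) x) \<in> borel_measurable lebesgue"
    using S by (intro borel_measurable_times borel_measurable_indicator) auto
  ultimately have "(\<lambda>x. (if x \<in> S - {a} then f x else 0) + f a * indicator ({a} \<inter> S) x)
      \<in> borel_measurable lebesgue"
    by (rule borel_measurable_add)
  also have "(\<lambda>x. (if x \<in> S - {a} then f x else 0) + f a * indicator ({a} \<inter> S) x)
      = (\<lambda>x. if x \<in> S then f x else 0)"
    by (auto simp: indicator_def)
  finally show "(\<lambda>x. if x \<in> S then f x else 0) \<in> borel_measurable lebesgue" .
qed

text \<open>
  Local integrability away from \<open>x0\<close> comes for free with the tail bound, because a compact subset of
  \<open>\<Omega> - {x0}\<close> keeps a positive distance from \<open>x0\<close>.
\<close>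

lemma mem_compl_Morrey_iff:
  assumes \<Omega>: "open \<Omega>" and p: "1 \<le> p"
  shows "f \<in> compl_Morrey p lam x0 \<Omega> \<longleftrightarrow>
    f \<in> borel_measurable (lebesgue_on \<Omega>) \<and>
    (\<exists>K\<ge>0. \<forall>r>0. Lp_int p (\<Omega> - ball x0 r) (\<lambda>_. 1) f \<le> ennreal (K * r powr - (lam * (p - 1))))"
    (is "_ \<longleftrightarrow> _ \<and> ?tail")
proof safe
  assume f: "f \<in> compl_Morrey p lam x0 \<Omega>"
  then show "f \<in> borel_measurable (lebesgue_on \<Omega>)"
    using \<Omega> by (auto simp: compl_Morrey_def Lp_loc_def intro: borel_measurable_lebesgue_on_insert_point)
  from f obtain M where "0 \<le> M" "compl_Morrey_norm p lam x0 \<Omega> f = ennreal M"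
    unfolding compl_Morrey_def by (auto simp: less_top_ennreal)
  then show ?tail
    using compl_Morrey_norm_le_iff[OF p, of M lam x0 \<Omega> f] by (intro exI[of _ "M powr p"]) auto
next
  fix K assume f: "f \<in> borel_measurable (lebesgue_on \<Omega>)" and K: "0 \<le> K"
    and tail: "\<forall>r>0. Lp_int p (\<Omega> - ball x0 r) (\<lambda>_. 1) f \<le> ennreal (K * r powr - (lam * (p - 1)))"
  have "compl_Morrey_norm p lam x0 \<Omega> f \<le> ennreal (K powr (1 / p))"
    using p K tail by (subst compl_Morrey_norm_le_iff) (auto simp: powr_powr)
  then have "compl_Morrey_norm p lam x0 \<Omega> f < \<infinity>"
    by (simp add: le_less_trans)
  moreover have "f \<in> Lp_loc p (\<Omega> - {x0})"
    unfolding Lp_loc_def Lp_space_def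
  proof safe
    show "f \<in> borel_measurable (lebesgue_on (\<Omega> - {x0}))"
      using f by (rule measurable_restrict_mono) auto
    fix X assume X: "compact X" "X \<subseteq> \<Omega> - {x0}"
    then show "f \<in> borel_measurable (lebesgue_on X)"
      using f by (elim measurable_restrict_mono) auto
    have "open (- X)" "x0 \<in> - X"
      using X compact_imp_closed by auto
    then obtain r where r: "0 < r" "ball x0 r \<subseteq> - X"
      by (meson open_contains_ball)
    have "X \<in> sets lebesgue" "\<Omega> - ball x0 r \<in> sets lebesgue"
      using X \<Omega> by (auto intro: lmeasurable_compact fmeasurableD)
    then have "Lp_int p X (\<lambda>_. 1) f \<le> Lp_int p (\<Omega> - ball x0 r) (\<lambda>_. 1) f"
      using X r by (intro Lp_int_mono_set) auto
    also have "\<dots> < \<infinity>"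
      using tail r by (metis ennreal_less_top infinity_ennreal_def le_less_trans)
    finally show "Lp_int p X (\<lambda>_. 1) f < \<infinity>" .
  qed
  ultimately show "f \<in> compl_Morrey p lam x0 \<Omega>"
    by (simp add: compl_Morrey_def)
qed

text \<open>
  Chebyshev's inequality for the weight: \<open>r powr \<beta> \<le> power_weight p lam x0 y\<close> whenever
  \<open>|y - x0| \<ge> r\<close>. The inclusion therefore has norm at most 1.
\<close>

lemma Lp_space_power_weight_embedded:
  fixes x0 :: "'a::euclidean_space"
  assumes \<Omega>: "open \<Omega>" and p: "1 \<le> p" and lam: "0 \<le> lam"
  shows "continuously_embedded
    (Lp_space p \<Omega> (power_weight p lam x0)) (Lp_norm p \<Omega> (power_weight p lam x0))
    (compl_Morrey p lam x0 \<Omega>) (compl_Morrey_norm p lam x0 \<Omega>)"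
proof -
  have tail: "Lp_int p (\<Omega> - ball x0 r) (\<lambda>_. 1) f
      \<le> ennreal (r powr - (lam * (p - 1))) * Lp_int p \<Omega> (power_weight p lam x0) f"
    if r: "0 < r" and f: "f \<in> borel_measurable (lebesgue_on \<Omega>)" for r f
  proof -
    have sets: "\<Omega> - ball x0 r \<in> sets lebesgue" using \<Omega> by auto
    have "Lp_int p (\<Omega> - ball x0 r) (\<lambda>_. 1) f
        \<le> (\<integral>\<^sup>+y. ennreal (r powr - (lam * (p - 1))) *
              ennreal (power_weight p lam x0 y * \<bar>f y\<bar> powr p) \<partial>lebesgue_on (\<Omega> - ball x0 r))"
      unfolding Lp_int_def
    proof (rule nn_integral_mono)
      fix y assume "y \<in> space (lebesgue_on (\<Omega> - ball x0 r))"
      then have "r \<le> norm (y - x0)"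
        by (simp add: dist_norm norm_minus_commute)
      then have "r powr (lam * (p - 1)) \<le> power_weight p lam x0 y"
        unfolding power_weight_def using r p lam by (intro powr_mono2) auto
      then have "1 \<le> r powr - (lam * (p - 1)) * power_weight p lam x0 y"
        using r by (simp add: powr_minus_divide del: minus_mult_right)
      then have "1 * \<bar>f y\<bar> powr p \<le> r powr - (lam * (p - 1)) * power_weight p lam x0 y * \<bar>f y\<bar> powr p"
        by (intro mult_right_mono) auto
      then show "ennreal (1 * \<bar>f y\<bar> powr p) \<le> ennreal (r powr - (lam * (p - 1))) *
              ennreal (power_weight p lam x0 y * \<bar>f y\<bar> powr p)"
        by (simp add: ennreal_mult'[symmetric] mult.assoc ennreal_leI)
    qed
    also have "\<dots> = ennreal (r powr - (lam * (p - 1))) * Lp_int p (\<Omega> - ball x0 r) (power_weight p lam x0) f"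
      unfolding Lp_int_def
    proof (rule nn_integral_cmult)
      have [measurable]: "f \<in> borel_measurable (lebesgue_on (\<Omega> - ball x0 r))"
        using f by (rule measurable_restrict_mono) auto
      have [measurable]: "power_weight p lam x0 \<in> borel_measurable (lebesgue_on (\<Omega> - ball x0 r))"
        unfolding power_weight_def by (rule borel_measurable_radial) simp
      show "(\<lambda>y. ennreal (power_weight p lam x0 y * \<bar>f y\<bar> powr p))
          \<in> borel_measurable (lebesgue_on (\<Omega> - ball x0 r))"
        by measurable
    qed
    also have "\<dots> \<le> ennreal (r powr - (lam * (p - 1))) * Lp_int p \<Omega> (power_weight p lam x0) f"
      using \<Omega> sets by (intro mult_left_mono Lp_int_mono_set) auto
    finally show ?thesis .
  qed
  have bound: "f \<in> compl_Morrey p lam x0 \<Omega> \<and>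
      compl_Morrey_norm p lam x0 \<Omega> f \<le> Lp_norm p \<Omega> (power_weight p lam x0) f"
    if f: "f \<in> Lp_space p \<Omega> (power_weight p lam x0)" for f
  proof -
    have meas: "f \<in> borel_measurable (lebesgue_on \<Omega>)"
      using f by (simp add: Lp_space_def)
    define c where "c = enn2real (Lp_int p \<Omega> (power_weight p lam x0) f) powr (1 / p)"
    have c: "0 \<le> c" "Lp_norm p \<Omega> (power_weight p lam x0) f = ennreal c"
      using f by (auto simp: Lp_space_def Lp_norm_def c_def)
    then have int: "Lp_int p \<Omega> (power_weight p lam x0) f \<le> ennreal (c powr p)"
      using Lp_norm_le_iff[of p c \<Omega> "power_weight p lam x0" f] p by simp
    have le: "Lp_int p (\<Omega> - ball x0 r) (\<lambda>_. 1) f \<le> ennreal (c powr p * r powr - (lam * (p - 1)))"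
      if "0 < r" for r
      using order_trans[OF tail[OF that meas] mult_left_mono[OF int]]
      by (simp add: ennreal_mult' mult.commute)
    then have "f \<in> compl_Morrey p lam x0 \<Omega>"
      unfolding mem_compl_Morrey_iff[OF \<Omega> p] using meas by (auto intro!: exI[of _ "c powr p"])
    moreover have "compl_Morrey_norm p lam x0 \<Omega> f \<le> ennreal c"
      using le c by (simp add: compl_Morrey_norm_le_iff p)
    ultimately show ?thesis using c by simp
  qed
  then show ?thesis
    unfolding continuously_embedded_def by (auto intro!: exI[of _ 1])
qed

lemma compl_Morrey_embedded_log_weight:
  fixes x0 :: "'a::euclidean_space"
  assumes \<Omega>: "open \<Omega>" and p: "1 \<le> p" and lam: "0 \<le> lam" and \<epsilon>: "0 < \<epsilon>"
    and D: "0 < D" "D < A" and \<Omega>D: "\<And>y. y \<in> \<Omega> \<Longrightarrow> norm (y - x0) \<le> D"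
  shows "continuously_embedded
    (compl_Morrey p lam x0 \<Omega>) (compl_Morrey_norm p lam x0 \<Omega>)
    (Lp_space p \<Omega> (log_weight p lam A \<epsilon> x0)) (Lp_norm p \<Omega> (log_weight p lam A \<epsilon> x0))"
proof -
  have \<beta>: "0 \<le> lam * (p - 1)" using p lam by simp
  define C where "C = log_tail_const D A (lam * (p - 1)) \<epsilon>"
  have C: "C > 0" using D \<epsilon> by (simp add: C_def log_tail_const_pos)
  have log_le: "Lp_int p \<Omega> (log_weight p lam A \<epsilon> x0) f \<le> ennreal (C * K)"
    if f [measurable]: "f \<in> borel_measurable (lebesgue_on \<Omega>)" and K: "0 \<le> K"
      and tail: "\<forall>r>0. Lp_int p (\<Omega> - ball x0 r) (\<lambda>_. 1) f \<le> ennreal (K * r powr - (lam * (p - 1)))"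
    for f K
  proof -
    define N where "N = density (lebesgue_on \<Omega>) (\<lambda>y. ennreal (\<bar>f y\<bar> powr p))"
    have \<rho> [measurable]: "(\<lambda>y. norm (y - x0)) \<in> borel_measurable (lebesgue_on S)" for S
      by (rule borel_measurable_radial) simp
    have "Lp_int p \<Omega> (log_weight p lam A \<epsilon> x0) f
        = (\<integral>\<^sup>+y. ennreal (norm (y - x0) powr (lam * (p - 1)) / ln (A / norm (y - x0)) powr (1 + \<epsilon>)) \<partial>N)"
      unfolding Lp_int_def N_def log_weight_def
      by (subst nn_integral_density)
         (auto intro!: nn_integral_cong simp: ennreal_mult'[symmetric] mult.commute)
    also have "\<dots> \<le> ennreal (C * K)"
      unfolding C_def
    proof (rule log_weight_integral_le_tail_bound)
      show "(\<lambda>y. norm (y - x0)) \<in> borel_measurable N"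
        unfolding N_def by simp
      show "0 \<le> norm (x - x0) \<and> norm (x - x0) \<le> D" if "x \<in> space N" for x
        using that \<Omega>D by (simp add: N_def)
      show "emeasure N {x \<in> space N. r \<le> norm (x - x0)} \<le> ennreal (K * r powr - (lam * (p - 1)))"
        if r: "0 < r" for r
      proof -
        have "emeasure N {x \<in> space N. r \<le> norm (x - x0)}
            = (\<integral>\<^sup>+y. ennreal (\<bar>f y\<bar> powr p) * indicator {y \<in> space (lebesgue_on \<Omega>). r \<le> norm (y - x0)} y
                \<partial>lebesgue_on \<Omega>)"
          unfolding N_def space_density by (rule emeasure_density) measurable
        also have "\<dots> = Lp_int p (\<Omega> - ball x0 r) (\<lambda>_. 1) f"
          unfolding Lp_int_def using \<Omega>
          by (subst (1 2) nn_integral_restrict_space)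
             (auto intro!: nn_integral_cong split: split_indicator simp: dist_norm norm_minus_commute)
        finally show ?thesis using tail r by simp
      qed
    qed (use D \<beta> \<epsilon> K in auto)
    finally show ?thesis .
  qed
  have "f \<in> Lp_space p \<Omega> (log_weight p lam A \<epsilon> x0) \<and> Lp_norm p \<Omega> (log_weight p lam A \<epsilon> x0) f
        \<le> ennreal (C powr (1 / p)) * compl_Morrey_norm p lam x0 \<Omega> f"
    if f: "f \<in> compl_Morrey p lam x0 \<Omega>" for f
  proof -
    have meas: "f \<in> borel_measurable (lebesgue_on \<Omega>)"
      using f by (simp add: mem_compl_Morrey_iff[OF \<Omega> p])
    obtain M where M: "0 \<le> M" "compl_Morrey_norm p lam x0 \<Omega> f = ennreal M"
      using f unfolding compl_Morrey_def by (auto simp: less_top_ennreal)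
    then have "\<forall>r>0. Lp_int p (\<Omega> - ball x0 r) (\<lambda>_. 1) f \<le> ennreal (M powr p * r powr - (lam * (p - 1)))"
      using compl_Morrey_norm_le_iff[OF p, of M lam x0 \<Omega> f] by simp
    then have le: "Lp_int p \<Omega> (log_weight p lam A \<epsilon> x0) f \<le> ennreal (C * M powr p)"
      using meas by (intro log_le) auto
    also have "C * M powr p = (C powr (1 / p) * M) powr p"
      using C p M by (simp add: powr_mult powr_powr)
    finally have "Lp_norm p \<Omega> (log_weight p lam A \<epsilon> x0) f \<le> ennreal (C powr (1 / p) * M)"
      using p M by (subst Lp_norm_le_iff) auto
    moreover have "Lp_int p \<Omega> (log_weight p lam A \<epsilon> x0) f < \<infinity>"
      using le by (simp add: le_less_trans)
    ultimately show ?thesis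
      using meas M by (simp add: Lp_space_def ennreal_mult')
  qed
  then show ?thesis
    unfolding continuously_embedded_def by (auto intro!: exI[of _ "C powr (1 / p)"])
qed

section \<open>Radial integrals over balls and annuli\<close>

text \<open>
  The exact measure has the additional factor \<open>2 ^ DIM('a) - 1\<close>, which is at least 1.
\<close>

lemma emeasure_annulus_ge:
  fixes x0 :: "'a::euclidean_space"
  assumes s: "0 < s"
  shows "ennreal (unit_ball_vol (real DIM('a)) * s ^ DIM('a))
    \<le> emeasure lebesgue (ball x0 (2 * s) - ball x0 s)"
proof -
  define v where "v = unit_ball_vol (real DIM('a))"
  have v: "0 \<le> v" by (simp add: v_def less_imp_le)
  have "(2::real) ^ 1 \<le> 2 ^ DIM('a)"
    by (intro power_increasing) (auto simp: Suc_leI)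
  then have "s ^ DIM('a) \<le> (2 * s) ^ DIM('a) - s ^ DIM('a)"
    using s mult_right_mono[of 2 "2 ^ DIM('a)" "s ^ DIM('a)"] by (simp add: power_mult_distrib)
  then have "v * s ^ DIM('a) \<le> v * (2 * s) ^ DIM('a) - v * s ^ DIM('a)"
    using v by (metis mult_left_mono right_diff_distrib)
  then have "ennreal (v * s ^ DIM('a)) \<le> ennreal (v * (2 * s) ^ DIM('a)) - ennreal (v * s ^ DIM('a))"
    using v s by (subst ennreal_minus) (auto intro: ennreal_leI)
  also have "\<dots> = emeasure lebesgue (ball x0 (2 * s)) - emeasure lebesgue (ball x0 s)"
    using s by (simp add: emeasure_ball v_def)
  also have "\<dots> = emeasure lebesgue (ball x0 (2 * s) - ball x0 s)"
    using s by (intro emeasure_Diff[symmetric]) (auto simp: emeasure_ball)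
  finally show ?thesis by (simp add: v_def)
qed

lemma annulus_integral_ge:
  fixes x0 :: "'a::euclidean_space" and h :: "'a \<Rightarrow> ennreal"
  assumes s: "0 < s" and a: "0 \<le> a"
    and h: "\<And>y. \<lbrakk>s \<le> norm (y - x0); norm (y - x0) < 2 * s\<rbrakk> \<Longrightarrow> ennreal a \<le> h y"
  shows "ennreal (a * (unit_ball_vol (real DIM('a)) * s ^ DIM('a)))
    \<le> (\<integral>\<^sup>+y. h y * indicator (ball x0 (2 * s) - ball x0 s) y \<partial>lebesgue)"
proof -
  have "ennreal (a * (unit_ball_vol (real DIM('a)) * s ^ DIM('a)))
      \<le> ennreal a * emeasure lebesgue (ball x0 (2 * s) - ball x0 s)"
    using a emeasure_annulus_ge[OF s, of x0] by (simp add: ennreal_mult' mult_left_mono)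
  also have "\<dots> = (\<integral>\<^sup>+y. ennreal a * indicator (ball x0 (2 * s) - ball x0 s) y \<partial>lebesgue)"
    by (rule nn_integral_cmult_indicator[symmetric]) auto
  also have "\<dots> \<le> (\<integral>\<^sup>+y. h y * indicator (ball x0 (2 * s) - ball x0 s) y \<partial>lebesgue)"
    using h by (intro nn_integral_mono) (auto split: split_indicator simp: dist_norm norm_minus_commute)
  finally show ?thesis .
qed

text \<open>
  At the exponent equal to the dimension all dyadic shells contribute at least the same constant
  \<open>c > 0\<close>: the integral over a ball exceeds that over the ball of half the radius by \<open>c\<close>. Iterating
  \<open>N\<close> times bounds the integral below by \<open>N c\<close>, for every \<open>N\<close> and every radius.
\<close>

lemma critical_power_integral_ball:
  fixes x0 :: "'a::euclidean_space"
  assumes "0 < R"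
  shows "(\<integral>\<^sup>+y. ennreal (norm (y - x0) powr - real DIM('a)) * indicator (ball x0 R) y \<partial>lebesgue) = \<infinity>"
proof -
  define c where "c = 2 powr - real DIM('a) * unit_ball_vol (real DIM('a))"
  have c: "0 < c" by (simp add: c_def)
  let ?h = "\<lambda>y. ennreal (norm (y - x0) powr - real DIM('a))"
  have h: "?h \<in> borel_measurable lebesgue"
    using borel_measurable_radial[of "\<lambda>t. t powr - real DIM('a)" x0 UNIV] by (simp add: lebesgue_on_UNIV_eq)
  have ge: "ennreal (real N * c) \<le> (\<integral>\<^sup>+y. ?h y * indicator (ball x0 R) y \<partial>lebesgue)" if "0 < R" for N R
    using that
  proof (induction N arbitrary: R)
    case (Suc N)
    define s where "s = R / 2"
    have s: "0 < s" "R = 2 * s" using Suc.prems by (auto simp: s_def)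
    have "c = (2 * s) powr - real DIM('a) * (unit_ball_vol (real DIM('a)) * s ^ DIM('a))"
      using s by (simp add: c_def powr_mult powr_minus powr_realpow)
    also have "ennreal \<dots> \<le> (\<integral>\<^sup>+y. ?h y * indicator (ball x0 (2 * s) - ball x0 s) y \<partial>lebesgue)"
      using s by (intro annulus_integral_ge ennreal_leI powr_mono2') auto
    finally have "ennreal (real N * c) + ennreal c \<le> (\<integral>\<^sup>+y. ?h y * indicator (ball x0 s) y \<partial>lebesgue)
        + (\<integral>\<^sup>+y. ?h y * indicator (ball x0 (2 * s) - ball x0 s) y \<partial>lebesgue)"
      using Suc.IH[OF s(1)] by (intro add_mono)
    also have "\<dots> = (\<integral>\<^sup>+y. ?h y * indicator (ball x0 s \<union> (ball x0 (2 * s) - ball x0 s)) y \<partial>lebesgue)"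
      by (rule nn_integral_disjoint_pair[symmetric, OF h]) auto
    also have "ball x0 s \<union> (ball x0 (2 * s) - ball x0 s) = ball x0 R"
      using s by auto
    finally show ?case
      using c by (simp add: distrib_right add.commute flip: ennreal_plus)
  qed simp
  show ?thesis
  proof (rule ccontr)
    assume "\<not> ?thesis"
    then obtain I where I: "0 \<le> I" "(\<integral>\<^sup>+y. ?h y * indicator (ball x0 R) y \<partial>lebesgue) = ennreal I"
      by (cases "\<integral>\<^sup>+y. ?h y * indicator (ball x0 R) y \<partial>lebesgue") auto
    obtain N :: nat where "I < real N * c"
      using reals_Archimedean3[OF c] by blast
    then show False
      using ge[OF assms, of N] I by (simp add: ennreal_le_iff)
  qed
qed

section \<open>The critical power and its logarithmic perturbation\<close>

text \<open>
  The inverse of this function is the borderline case: its \<open>p\<close>-th power, multiplied by the power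
  weight, is \<open>|x - x0| powr - DIM('a)\<close>.
\<close>

abbreviation critical_power :: "real \<Rightarrow> real \<Rightarrow> 'a::euclidean_space \<Rightarrow> 'a \<Rightarrow> real" where
  "critical_power p lam x0 x \<equiv> norm (x - x0) powr (real DIM('a) / p + lam * (1 - 1 / p))"

lemma critical_power_powr:
  fixes x0 :: "'a::euclidean_space"
  assumes "1 \<le> p"
  shows "critical_power p lam x0 x powr p = norm (x - x0) powr (real DIM('a) + lam * (p - 1))"
proof -
  have "(real DIM('a) / p + lam * (1 - 1 / p)) * p = real DIM('a) + lam * (p - 1)"
    using assms by (simp add: field_simps)
  then show ?thesis by (simp add: powr_powr)
qed

text \<open>
  This also holds at \<open>x = x0\<close>, where both sides are \<open>0\<close> by the conventions for \<open>powr\<close> and division.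
\<close>

lemma divide_critical_power_powr:
  fixes x0 :: "'a::euclidean_space"
  assumes "1 \<le> p" 
  shows "\<bar>c / critical_power p lam x0 x\<bar> powr p
    = \<bar>c\<bar> powr p * norm (x - x0) powr - (real DIM('a) + lam * (p - 1))"
  using assms by (simp add: abs_divide powr_divide critical_power_powr powr_minus_divide del: minus_add_distrib)

lemma critical_power_in_compl_Morrey:
  fixes x0 :: "'a::euclidean_space"
  assumes \<Omega>: "open \<Omega>" and p: "1 < p" and lam: "0 < lam"
  shows "(\<lambda>x. 1 / critical_power p lam x0 x) \<in> compl_Morrey p lam x0 \<Omega>"
proof -
  define d where "d = real DIM('a)"
  have v: "0 \<le> unit_ball_vol d" by (simp add: d_def less_imp_le)
  have \<beta>: "0 < lam * (p - 1)" using p lam by simp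
  have d: "0 \<le> d" by (simp add: d_def)
  define C where "C = unit_ball_vol d * 2 powr d / (1 - 2 powr - (lam * (p - 1)))"
  have C: "0 \<le> C" using v \<beta> by (simp add: C_def powr_less_one less_imp_le)
  have "Lp_int p (\<Omega> - ball x0 r) (\<lambda>_. 1) (\<lambda>x. 1 / critical_power p lam x0 x)
      \<le> ennreal (C * r powr - (lam * (p - 1)))" if r: "0 < r" for r
  proof -
    have "Lp_int p (\<Omega> - ball x0 r) (\<lambda>_. 1) (\<lambda>x. 1 / critical_power p lam x0 x)
       = (\<integral>\<^sup>+x. ennreal (norm (x - x0) powr - (d + lam * (p - 1))) * indicator (\<Omega> - ball x0 r) x \<partial>lebesgue)"
      unfolding Lp_int_def d_def divide_critical_power_powr[OF less_imp_le[OF p]] using \<Omega>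
      by (subst nn_integral_restrict_space) auto
    also have "\<dots> \<le> (\<integral>\<^sup>+x. ennreal (norm (x - x0) powr - (d + lam * (p - 1)))
        * indicator {x. r \<le> norm (x - x0)} x \<partial>lebesgue)"
      by (intro nn_integral_mono) (auto split: split_indicator simp: dist_norm norm_minus_commute)
    also have "\<dots> \<le> ennreal (C * r powr - (lam * (p - 1)))"
      unfolding C_def
    proof (rule power_tail_integral_le)
      show "(\<lambda>x. norm (x - x0)) \<in> borel_measurable lebesgue"
        using borel_measurable_radial[of "\<lambda>t. t" x0 UNIV] by (simp add: lebesgue_on_UNIV_eq)
      fix s :: real assume s: "0 < s"
      have "{x \<in> space lebesgue. norm (x - x0) < s} = ball x0 s"
        by (auto simp: dist_norm norm_minus_commute)
      then show "emeasure lebesgue {x \<in> space lebesgue. norm (x - x0) < s} \<le> ennreal (unit_ball_vol d * s powr d)"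
        using s by (simp add: emeasure_ball d_def powr_realpow)
    qed (use r v d \<beta> in auto)
    finally show ?thesis .
  qed
  moreover have "(\<lambda>x. 1 / critical_power p lam x0 x) \<in> borel_measurable (lebesgue_on \<Omega>)"
    by (rule borel_measurable_radial) simp
  ultimately show ?thesis
    using C p by (subst mem_compl_Morrey_iff[OF \<Omega>]) auto
qed

lemma critical_power_notin_Lp_space:
  fixes x0 :: "'a::euclidean_space"
  assumes \<Omega>: "open \<Omega>" "x0 \<in> \<Omega>" and p: "1 \<le> p"
  shows "(\<lambda>x. 1 / critical_power p lam x0 x) \<notin> Lp_space p \<Omega> (power_weight p lam x0)"
proof -
  obtain R where R: "0 < R" "ball x0 R \<subseteq> \<Omega>"
    using \<Omega> by (meson open_contains_ball)
  have "\<infinity> = (\<integral>\<^sup>+y. ennreal (norm (y - x0) powr - real DIM('a)) * indicator (ball x0 R) y \<partial>lebesgue)"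
    using critical_power_integral_ball[OF R(1), of x0] by simp
  also have "\<dots> \<le> (\<integral>\<^sup>+y. ennreal (norm (y - x0) powr - real DIM('a)) * indicator \<Omega> y \<partial>lebesgue)"
    using R by (intro nn_integral_mono) (auto split: split_indicator)
  also have "\<dots> = Lp_int p \<Omega> (power_weight p lam x0) (\<lambda>x. 1 / critical_power p lam x0 x)"
    unfolding Lp_int_def divide_critical_power_powr[OF p] power_weight_def using \<Omega>
    by (subst nn_integral_restrict_space) (auto simp flip: powr_add)
  finally show ?thesis by (simp add: Lp_space_def top_unique)
qed

text \<open>
  An iterated logarithm grows more slowly than any power of the logarithm:
  \<open>ln u \<le> u powr \<delta> / \<delta>\<close> for \<open>u = ln (B / t) \<ge> 1\<close>, with \<open>\<delta> = \<epsilon> / p\<close>. Moreover \<open>ln (B / t)\<close> and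
  \<open>ln (A / t)\<close> are comparable on \<open>0 < t \<le> D\<close>, since both differ from \<open>ln (D / t)\<close> by a positive
  constant.
\<close>

lemma lnln_powr_le_ln_powr:
  fixes p \<epsilon> A B D :: real
  assumes p: "0 < p" and \<epsilon>: "0 < \<epsilon>" and D: "0 < D" "D < A" "D * exp (exp 1) < B"
  shows "\<exists>C\<ge>0. \<forall>t. 0 < t \<longrightarrow> t \<le> D \<longrightarrow> \<bar>ln (ln (B / t))\<bar> powr p \<le> C * ln (A / t) powr \<epsilon>"
proof -
  define a where "a = ln (A / D)"
  define b where "b = ln (B / D)"
  define \<delta> where "\<delta> = \<epsilon> / p"
  have \<delta>: "0 < \<delta>" using p \<epsilon> by (simp add: \<delta>_def)
  have a: "0 < a" using D by (simp add: a_def)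
  have "exp (exp 1) < B / D" using D by (simp add: field_simps)
  then have b: "exp 1 < b"
    using D unfolding b_def by (metis exp_gt_zero less_trans ln_exp ln_less_cancel_iff)
  have B: "0 < B" using D by (smt (verit) exp_gt_zero mult_pos_pos)
  have "\<bar>ln (ln (B / t))\<bar> powr p \<le> ((1 / \<delta>) powr p * (b / a + 1) powr \<epsilon>) * ln (A / t) powr \<epsilon>"
    if t: "0 < t" "t \<le> D" for t
  proof -
    define L where "L = ln (D / t)"
    have L: "0 \<le> L" using t D by (simp add: L_def)
    have Bt: "ln (B / t) = b + L" and At: "ln (A / t) = a + L"
      using t D B by (auto simp: L_def a_def b_def ln_div)
    have "exp 1 \<le> b + L" using b L by linarith
    have "1 \<le> b + L" using \<open>exp 1 \<le> b + L\<close> exp_ge_add_one_self[of 1] by linarith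
    have "0 \<le> ln (b + L)" using \<open>1 \<le> b + L\<close> by simp
    have "b + L \<le> (b / a + 1) * (a + L)"
      using a b L by (simp add: field_simps) (smt (verit, best) exp_gt_zero mult_nonneg_nonneg)
    have "\<bar>ln (b + L)\<bar> powr p \<le> ((b + L) powr \<delta> / \<delta>) powr p"
      using ln_powr_bound[OF \<open>1 \<le> b + L\<close> \<delta>] \<open>0 \<le> ln (b + L)\<close> p by (intro powr_mono2) auto
    also have "\<dots> = (1 / \<delta>) powr p * ((b + L) powr \<delta>) powr p"
      using \<delta> by (simp add: powr_divide)
    also have "((b + L) powr \<delta>) powr p = (b + L) powr \<epsilon>"
      using p by (simp add: powr_powr \<delta>_def)
    also have "(1 / \<delta>) powr p * (b + L) powr \<epsilon> \<le> (1 / \<delta>) powr p * ((b / a + 1) * (a + L)) powr \<epsilon>"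
      using \<open>b + L \<le> _\<close> \<open>1 \<le> b + L\<close> \<epsilon> by (intro mult_left_mono powr_mono2) auto
    also have "((b / a + 1) * (a + L)) powr \<epsilon> = (b / a + 1) powr \<epsilon> * (a + L) powr \<epsilon>"
      by (rule powr_mult)
    finally show ?thesis by (simp add: Bt At mult.assoc)
  qed
  then show ?thesis by (intro exI[of _ "(1 / \<delta>) powr p * (b / a + 1) powr \<epsilon>"]) auto
qed

text \<open>
  Half of \<open>\<epsilon>\<close> is spent on the iterated logarithm; it remains to integrate
  \<open>\<rho> powr - n / ln (A / \<rho>) powr (1 + \<epsilon> / 2)\<close>, which no longer depends on \<open>p\<close> and \<open>lam\<close>. To avoid a
  separate computation, this is read as the integral for the inverse critical power with exponents
  \<open>2\<close> and \<open>1\<close>, which belongs to the complementary Morrey space for these exponents, so that the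
  embedding applies. The exponents of the function itself would not do: for \<open>p = 1\<close> or
  \<open>lam = 0\<close> its inverse critical power is not in the complementary Morrey space.
\<close>

lemma lnln_critical_power_in_log_weight:
  fixes x0 :: "'a::euclidean_space"
  assumes \<Omega>: "open \<Omega>" and p: "1 \<le> p" and lam: "0 \<le> lam" and \<epsilon>: "0 < \<epsilon>"
    and D: "0 < D" "D < A" and \<Omega>D: "\<And>y. y \<in> \<Omega> \<Longrightarrow> norm (y - x0) \<le> D"
    and B: "D * exp (exp 1) < B"
  shows "(\<lambda>x. ln (ln (B / norm (x - x0))) / critical_power p lam x0 x)
    \<in> Lp_space p \<Omega> (log_weight p lam A \<epsilon> x0)"
    (is "?g \<in> _")
proof -
  let ?f = "\<lambda>x. 1 / critical_power 2 1 x0 x"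
  have "0 < p" "0 < \<epsilon> / 2" using p \<epsilon> by auto
  then obtain C where C: "C \<ge> 0"
    and g_le: "\<And>t. \<lbrakk>0 < t; t \<le> D\<rbrakk> \<Longrightarrow> \<bar>ln (ln (B / t))\<bar> powr p \<le> C * ln (A / t) powr (\<epsilon> / 2)"
    using lnln_powr_le_ln_powr[of p "\<epsilon> / 2" D A B] D B by blast
  have "?f \<in> compl_Morrey 2 1 x0 \<Omega>"
    using \<Omega> by (rule critical_power_in_compl_Morrey) auto
  then have f: "?f \<in> Lp_space 2 \<Omega> (log_weight 2 1 A (\<epsilon> / 2) x0)"
    using compl_Morrey_embedded_log_weight[OF \<Omega>, of 2 1 "\<epsilon> / 2" D A x0] D \<Omega>D \<epsilon>
    by (auto simp: continuously_embedded_def)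
  have meas_f [measurable]: "?f \<in> borel_measurable (lebesgue_on \<Omega>)"
    by (rule borel_measurable_radial) simp
  have meas_w [measurable]: "log_weight 2 1 A (\<epsilon> / 2) x0 \<in> borel_measurable (lebesgue_on \<Omega>)"
    unfolding log_weight_def by (rule borel_measurable_radial) simp
  have "Lp_int p \<Omega> (log_weight p lam A \<epsilon> x0) ?g
     \<le> (\<integral>\<^sup>+y. ennreal C * ennreal (log_weight 2 1 A (\<epsilon> / 2) x0 y * \<bar>?f y\<bar> powr 2) \<partial>lebesgue_on \<Omega>)"
    unfolding Lp_int_def
  proof (rule nn_integral_mono)
    fix y assume "y \<in> space (lebesgue_on \<Omega>)"
    then have yD: "norm (y - x0) \<le> D" using \<Omega>D by simp
    show "ennreal (log_weight p lam A \<epsilon> x0 y * \<bar>?g y\<bar> powr p)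
        \<le> ennreal C * ennreal (log_weight 2 1 A (\<epsilon> / 2) x0 y * \<bar>?f y\<bar> powr 2)"
    proof (cases "y = x0")
      case False
      define t where "t = norm (y - x0)"
      define l where "l = ln (A / t)"
      define d where "d = real DIM('a)"
      have t: "0 < t" "t \<le> D" using False yD by (auto simp: t_def)
      have l: "0 < l" using t D by (simp add: l_def)
      have "log_weight p lam A \<epsilon> x0 y * \<bar>?g y\<bar> powr p
          = \<bar>ln (ln (B / t))\<bar> powr p * (t powr (lam * (p - 1)) * t powr - (d + lam * (p - 1))) / l powr (1 + \<epsilon>)"
        unfolding divide_critical_power_powr[OF p] log_weight_def
        by (simp add: t_def l_def d_def del: minus_add_distrib)
      also have "t powr (lam * (p - 1)) * t powr - (d + lam * (p - 1)) = t powr - d"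
        by (simp flip: powr_add)
      also have "\<bar>ln (ln (B / t))\<bar> powr p * t powr - d / l powr (1 + \<epsilon>)
          \<le> (C * l powr (\<epsilon> / 2)) * t powr - d / l powr (1 + \<epsilon>)"
        using g_le[OF t] unfolding l_def by (intro divide_right_mono mult_right_mono) auto
      also have "l powr (1 + \<epsilon>) = l powr (\<epsilon> / 2) * l powr (1 + \<epsilon> / 2)"
        by (simp add: add.commute flip: powr_add)
      also have "(C * l powr (\<epsilon> / 2)) * t powr - d / \<dots> = C * (t powr - d / l powr (1 + \<epsilon> / 2))"
        using l by simp
      also have "t powr - d = t powr (1 * (2 - 1)) * t powr - (d + 1 * (2 - 1))"
        unfolding powr_add[symmetric] by simp
      also have "\<dots> / l powr (1 + \<epsilon> / 2) = log_weight 2 1 A (\<epsilon> / 2) x0 y * \<bar>?f y\<bar> powr 2"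
        using divide_critical_power_powr[where p = 2 and c = 1 and lam = 1 and x = y and x0 = x0] unfolding log_weight_def
        by (simp add: t_def l_def d_def del: minus_add_distrib)
      finally show ?thesis
        using C by (simp add: ennreal_mult'[symmetric] ennreal_leI)
    qed (simp add: log_weight_def)
  qed
  also have "\<dots> = ennreal C * Lp_int 2 \<Omega> (log_weight 2 1 A (\<epsilon> / 2) x0) ?f"
    unfolding Lp_int_def by (rule nn_integral_cmult) measurable
  also have "\<dots> < \<infinity>"
    using f by (simp add: Lp_space_def ennreal_mult_less_top)
  finally have "Lp_int p \<Omega> (log_weight p lam A \<epsilon> x0) ?g < \<infinity>" .
  moreover have "?g \<in> borel_measurable (lebesgue_on \<Omega>)"
    by (rule borel_measurable_radial) simp
  ultimately show ?thesis by (simp add: Lp_space_def)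
qed

text \<open>
  On the annulus \<open>s \<le> \<rho> < 2 s\<close> the iterated logarithm is at least \<open>ln (ln (B / (2 s)))\<close>, and the
  remaining factor integrates to a constant times \<open>s powr - \<beta>\<close>. Hence the \<open>p\<close>-th power of
  \<open>ln (ln (B / (2 s)))\<close> would stay bounded as \<open>s\<close> tends to \<open>0\<close>.
\<close>

lemma lnln_critical_power_notin_compl_Morrey:
  fixes x0 :: "'a::euclidean_space"
  assumes \<Omega>: "open \<Omega>" "x0 \<in> \<Omega>" and p: "1 \<le> p" and lam: "0 \<le> lam" and B: "0 < B"
  shows "(\<lambda>x. ln (ln (B / norm (x - x0))) / critical_power p lam x0 x) \<notin> compl_Morrey p lam x0 \<Omega>"
    (is "?g \<notin> _")
proof
  assume "?g \<in> compl_Morrey p lam x0 \<Omega>"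
  then obtain K where K: "0 \<le> K"
    and tail: "\<And>r. 0 < r \<Longrightarrow> Lp_int p (\<Omega> - ball x0 r) (\<lambda>_. 1) ?g \<le> ennreal (K * r powr - (lam * (p - 1)))"
    using mem_compl_Morrey_iff[OF \<Omega>(1) p] by blast
  obtain R where R: "0 < R" "ball x0 R \<subseteq> \<Omega>"
    using \<Omega> by (meson open_contains_ball)
  define d where "d = real DIM('a)"
  define \<beta> where "\<beta> = lam * (p - 1)"
  define v where "v = unit_ball_vol d"
  have v: "0 < v" by (simp add: v_def d_def)
  have \<beta>: "0 \<le> \<beta>" using lam p by (simp add: \<beta>_def)
  \<comment> \<open>\<open>T\<close> will be a lower bound of the iterated logarithm on the annulus \<open>s \<le> \<rho> < 2 * s\<close>: the first
      entry makes it exceed what the tail bound permits, the second puts the annulus inside \<open>ball x0 R\<close>.\<close>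
  define T where "T = max (K * 2 powr (d + \<beta>) / v + 1) (B / R)"
  define s where "s = B / exp (exp T) / 2"
  have s: "0 < s" using B by (simp add: s_def)
  have "0 \<le> K * 2 powr (d + \<beta>) / v" using K v by simp
  then have T1: "1 \<le> T" by (simp add: T_def max_def)
  have "B / R \<le> exp (exp T)"
    using exp_ge_add_one_self[of T] exp_ge_add_one_self[of "exp T"] unfolding T_def by linarith
  then have sR: "2 * s \<le> R"
    using R B by (simp add: s_def field_simps)
  have lnln: "T \<le> ln (ln (B / t))" if "0 < t" "t \<le> 2 * s" for t
  proof -
    have "exp (exp T) \<le> B / t"
      using that B by (simp add: s_def field_simps)
    then have "exp T \<le> ln (B / t)"
      using that B by (simp add: ln_ge_iff)
    then show ?thesis
      by (metis exp_gt_zero less_le_trans ln_ge_iff)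
  qed
  have "ennreal ((T powr p * (2 * s) powr - (d + \<beta>)) * (v * s ^ DIM('a)))
      \<le> (\<integral>\<^sup>+y. ennreal (\<bar>?g y\<bar> powr p) * indicator (ball x0 (2 * s) - ball x0 s) y \<partial>lebesgue)"
    unfolding v_def d_def
  proof (rule annulus_integral_ge[OF s])
    fix y assume y: "s \<le> norm (y - x0)" "norm (y - x0) < 2 * s"
    have "T \<le> ln (ln (B / norm (y - x0)))"
      using y s by (intro lnln) linarith+
    then have "T powr p \<le> \<bar>ln (ln (B / norm (y - x0)))\<bar> powr p"
      using T1 p by (intro powr_mono2) auto
    moreover have "(2 * s) powr - (real DIM('a) + \<beta>) \<le> norm (y - x0) powr - (real DIM('a) + \<beta>)"
      using y s \<beta> by (intro powr_mono2') auto
    ultimately show "ennreal (T powr p * (2 * s) powr - (real DIM('a) + \<beta>)) \<le> ennreal (\<bar>?g y\<bar> powr p)"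
      unfolding divide_critical_power_powr[OF p] \<beta>_def by (intro ennreal_leI mult_mono) auto
  qed simp
  also have "\<dots> \<le> (\<integral>\<^sup>+y. ennreal (\<bar>?g y\<bar> powr p) * indicator (\<Omega> - ball x0 s) y \<partial>lebesgue)"
    using R sR by (intro nn_integral_mono) (auto split: split_indicator simp: subset_eq)
  also have "\<dots> = Lp_int p (\<Omega> - ball x0 s) (\<lambda>_. 1) ?g"
    unfolding Lp_int_def using \<Omega> by (subst nn_integral_restrict_space) auto
  also have "\<dots> \<le> ennreal (K * s powr - \<beta>)"
    using tail[OF s] by (simp add: \<beta>_def)
  finally have "(T powr p * (2 * s) powr - (d + \<beta>)) * (v * s ^ DIM('a)) \<le> K * s powr - \<beta>"
    using K by (simp add: ennreal_le_iff)
  also have "(T powr p * (2 * s) powr - (d + \<beta>)) * (v * s ^ DIM('a))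
      = T powr p * 2 powr - (d + \<beta>) * v * s powr - \<beta>"
  proof -
    have "(2 * s) powr - (d + \<beta>) = 2 powr - (d + \<beta>) * s powr - (d + \<beta>)"
      by (rule powr_mult)
    then have "(T powr p * (2 * s) powr - (d + \<beta>)) * (v * s ^ DIM('a))
        = T powr p * 2 powr - (d + \<beta>) * v * (s powr - (d + \<beta>) * s ^ DIM('a))"
      by (simp only: mult_ac)
    also have "s powr - (d + \<beta>) * s ^ DIM('a) = s powr - \<beta>"
      using s by (simp add: d_def flip: powr_realpow powr_add)
    finally show ?thesis .
  qed
  finally have "T powr p * 2 powr - (d + \<beta>) * v \<le> K"
    using s by simp
  then have "T powr p \<le> K * 2 powr (d + \<beta>) / v"
    using v by (simp add: powr_minus_divide field_simps del: minus_add_distrib)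
  moreover have "T powr 1 \<le> T powr p"
    using T1 p by (intro powr_mono) auto
  moreover have "K * 2 powr (d + \<beta>) / v + 1 \<le> T"
    by (simp add: T_def)
  ultimately show False using T1 by simp
qed

section \<open>The two strict embeddings\<close>

theorem theorem2p1:
  fixes \<Omega> :: "(real ^ 'n) set" and x0 :: "real ^ 'n" and p lam A :: real
  assumes "open \<Omega>" and "bounded \<Omega>" and "x0 \<in> \<Omega>"
    and "1 \<le> p" and "0 \<le> lam" and "lam \<le> real CARD('n)"
    and "A > diameter \<Omega>"
  shows
    "continuously_embedded
       (Lp_space p \<Omega> (power_weight p lam x0)) (Lp_norm p \<Omega> (power_weight p lam x0))
       (compl_Morrey p lam x0 \<Omega>) (compl_Morrey_norm p lam x0 \<Omega>)
     \<and> (\<forall>\<epsilon>>0. continuously_embedded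
          (compl_Morrey p lam x0 \<Omega>) (compl_Morrey_norm p lam x0 \<Omega>)
          (Lp_space p \<Omega> (log_weight p lam A \<epsilon> x0)) (Lp_norm p \<Omega> (log_weight p lam A \<epsilon> x0)))
     \<and> (1 < p \<and> 0 < lam \<longrightarrow>
          Lp_space p \<Omega> (power_weight p lam x0) \<subset> compl_Morrey p lam x0 \<Omega>
          \<and> (let f = (\<lambda>x. 1 / norm (x - x0) powr (real CARD('n) / p + lam * (1 - 1 / p)))
             in f \<in> compl_Morrey p lam x0 \<Omega> \<and> f \<notin> Lp_space p \<Omega> (power_weight p lam x0)))
     \<and> compl_Morrey p lam x0 \<Omega> \<subset> (\<Inter>\<epsilon>\<in>{0<..}. Lp_space p \<Omega> (log_weight p lam A \<epsilon> x0))
     \<and> (\<forall>B. B > diameter \<Omega> * exp (exp 1) \<longrightarrow>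
          (let g = (\<lambda>x. ln (ln (B / norm (x - x0)))
                        / norm (x - x0) powr (real CARD('n) / p + lam * (1 - 1 / p)))
           in g \<in> (\<Inter>\<epsilon>\<in>{0<..}. Lp_space p \<Omega> (log_weight p lam A \<epsilon> x0))
              \<and> g \<notin> compl_Morrey p lam x0 \<Omega>))"
proof -
  define D where "D = diameter \<Omega>"
  have \<Omega>D: "norm (y - x0) \<le> D" if "y \<in> \<Omega>" for y
    using diameter_bounded_bound[OF assms(2) that assms(3)] by (simp add: D_def dist_norm)
  obtain R where R: "0 < R" "ball x0 R \<subseteq> \<Omega>"
    using assms(1,3) by (meson open_contains_ball)
  then have "0 < diameter (ball x0 R)" by simp
  also have "\<dots> \<le> D"
    unfolding D_def using R assms(2) by (intro diameter_subset) auto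
  finally have D: "0 < D" .
  have DA: "D < A" using assms(7) by (simp add: D_def)
  have emb1: "continuously_embedded
       (Lp_space p \<Omega> (power_weight p lam x0)) (Lp_norm p \<Omega> (power_weight p lam x0))
       (compl_Morrey p lam x0 \<Omega>) (compl_Morrey_norm p lam x0 \<Omega>)"
    using assms by (intro Lp_space_power_weight_embedded)
  have emb2: "continuously_embedded
          (compl_Morrey p lam x0 \<Omega>) (compl_Morrey_norm p lam x0 \<Omega>)
          (Lp_space p \<Omega> (log_weight p lam A \<epsilon> x0)) (Lp_norm p \<Omega> (log_weight p lam A \<epsilon> x0))"
    if "0 < \<epsilon>" for \<epsilon>
    using assms(1,4,5) that D DA \<Omega>D by (rule compl_Morrey_embedded_log_weight)
  have f: "(\<lambda>x. 1 / critical_power p lam x0 x) \<in> compl_Morrey p lam x0 \<Omega>" if "1 < p" "0 < lam"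
    using assms(1) that by (rule critical_power_in_compl_Morrey)
  have f': "(\<lambda>x. 1 / critical_power p lam x0 x) \<notin> Lp_space p \<Omega> (power_weight p lam x0)"
    using assms(1,3,4) by (rule critical_power_notin_Lp_space)
  have g: "(\<lambda>x. ln (ln (B / norm (x - x0))) / critical_power p lam x0 x)
      \<in> (\<Inter>\<epsilon>\<in>{0<..}. Lp_space p \<Omega> (log_weight p lam A \<epsilon> x0))"
    if "B > D * exp (exp 1)" for B
    using lnln_critical_power_in_log_weight[OF assms(1,4,5) _ D DA \<Omega>D that] by auto
  have g': "(\<lambda>x. ln (ln (B / norm (x - x0))) / critical_power p lam x0 x) \<notin> compl_Morrey p lam x0 \<Omega>"
    if "B > D * exp (exp 1)" for B
  proof (rule lnln_critical_power_notin_compl_Morrey)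
    show "0 < B" using that D by (smt (verit) exp_gt_zero mult_pos_pos)
  qed (use assms in auto)
  have strict1: "Lp_space p \<Omega> (power_weight p lam x0) \<subset> compl_Morrey p lam x0 \<Omega>" if "1 < p" "0 < lam"
    using emb1 f[OF that] f' by (auto simp: continuously_embedded_def)
  have "compl_Morrey p lam x0 \<Omega> \<subseteq> (\<Inter>\<epsilon>\<in>{0<..}. Lp_space p \<Omega> (log_weight p lam A \<epsilon> x0))"
    using emb2 by (auto simp: continuously_embedded_def)
  then have strict2: "compl_Morrey p lam x0 \<Omega> \<subset> (\<Inter>\<epsilon>\<in>{0<..}. Lp_space p \<Omega> (log_weight p lam A \<epsilon> x0))"
    using g[of "D * exp (exp 1) + 1"] g'[of "D * exp (exp 1) + 1"] by auto
  have dim: "DIM(real ^ 'n) = CARD('n)" by simp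
  show ?thesis
    unfolding Let_def
  proof (intro conjI allI impI)
  qed (use emb1 emb2 strict1 strict2 f[unfolded dim] f'[unfolded dim] g[unfolded dim D_def]
      g'[unfolded dim D_def] in \<open>simp_all\<close>)
qed

end
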